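(* For all terms $u$, $f$, $t$ and every variable $x$, the star abstraction $\lambda x.u$ is syntactically different from ${\bf tagged}\{f,t\}$.
   Context: Terms are given by the grammar $p ::= S \mid K \mid p\,q \mid y$, where $S$ and $K$ are constants, $y$ ranges over term variables, and application is left-associative; equality of terms is syntactic equality. Let $I = SKK$, and let ${\bf fv}(t)$ denote the set of variables occurring in $t$. Star abstraction $\lambda x.t$ is defined by recursion on $t$: if $t$ is a variable $y$, then $\lambda x.t = I$ if $y = x$ and $\lambda x.t = K\,y$ otherwise; $\lambda x.S = KS$; $\lambda x.K = KK$; and for an application $t = t_1\,t_2$, $\lambda x.t = S(\lambda x.t_1)(\lambda x.t_2)$ if $x \in {\bf fv}(t_1 t_2)$, and $\lambda x.t = K(t_1 t_2)$ otherwise. Define ${\bf tagged}\{f,t\} = S(S(KK)f)\big(S(S(KK)(KK))(Kt)\big)$ for terms $f,t$. *)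

theory Defs
  imports Main
begin

datatype (fv: 'v) cterm =
    S
  | K
  | App "'v cterm" "'v cterm" (infixl "\<cdot>" 90)
  | Var 'v

definition I :: "'v cterm" where
  "I = S \<cdot> K \<cdot> K"

primrec star :: "'v \<Rightarrow> 'v cterm \<Rightarrow> 'v cterm" where
  "star x (Var y) = (if y = x then I else K \<cdot> Var y)"
| "star x S = K \<cdot> S"
| "star x K = K \<cdot> K"
| "star x (t1 \<cdot> t2) =
     (if x \<in> fv (t1 \<cdot> t2) then S \<cdot> star x t1 \<cdot> star x t2 else K \<cdot> (t1 \<cdot> t2))"

definition tagged :: "'v cterm \<Rightarrow> 'v cterm \<Rightarrow> 'v cterm" where
  "tagged f t = S \<cdot> (S \<cdot> (K \<cdot> K) \<cdot> f) \<cdot> (S \<cdot> (S \<cdot> (K \<cdot> K) \<cdot> (K \<cdot> K)) \<cdot> (K \<cdot> t))"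

end

theory Submission
  imports Defs
begin

text \<open>
  A star abstraction of the form \<open>K q\<close> arises only from a body without \<open>x\<close>, whereas one of
  the form \<open>S p q\<close> with \<open>p \<noteq> K\<close> (so that it is not \<open>I\<close>) arises only from an application
  containing \<open>x\<close>. The subterm \<open>S (K K) (K K)\<close> of a tagged term would have to be the
  abstraction of an application containing \<open>x\<close>, neither side of which contains \<open>x\<close>.
\<close>

lemma star_eq_K_App_imp_not_fv:
  "star x u = K \<cdot> q \<Longrightarrow> x \<notin> fv u"
  by (cases u) (auto simp: I_def split: if_splits)

lemma star_eq_S_AppE:
  assumes "star x u = S \<cdot> p \<cdot> q" and "p \<noteq> K"
  obtains u1 u2 where "x \<in> fv (u1 \<cdot> u2)" "star x u1 = p" "star x u2 = q"
  using assms by (cases u) (auto simp: I_def split: if_splits)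

text \<open>The occurrence check in \<open>star\<close> is decisive: an application of two terms
  without \<open>x\<close> is abstracted to \<open>K\<close> of the whole, never distributed by
  \<open>S\<close>.\<close>

lemma star_neq_S_K_K: "star x u \<noteq> S \<cdot> (K \<cdot> p) \<cdot> (K \<cdot> q)"
proof
  assume "star x u = S \<cdot> (K \<cdot> p) \<cdot> (K \<cdot> q)"
  then obtain u1 u2 where "x \<in> fv (u1 \<cdot> u2)" "star x u1 = K \<cdot> p" "star x u2 = K \<cdot> q"
    by (rule star_eq_S_AppE) simp
  then show False
    by (auto dest: star_eq_K_App_imp_not_fv)
qed

theorem mainTheorem2:
  fixes u f t :: "'v cterm" and x :: 'v
  shows "star x u \<noteq> tagged f t"
proof
  assume "star x u = tagged f t"
  \<comment> \<open>\<open>v\<close> is the right half of the application \<open>u\<close>;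
    \<open>simp\<close> checks that \<open>S \<cdot> (K \<cdot> K) \<cdot> f\<close> is not
    \<open>K\<close>.\<close>
  then obtain v where "star x v = S \<cdot> (S \<cdot> (K \<cdot> K) \<cdot> (K \<cdot> K)) \<cdot> (K \<cdot> t)"
    unfolding tagged_def by (rule star_eq_S_AppE) simp
  \<comment> \<open>\<open>w\<close> is the left half of \<open>v\<close>; its abstraction no longer
    involves \<open>f\<close> or \<open>t\<close>.\<close>
  then obtain w where "star x w = S \<cdot> (K \<cdot> K) \<cdot> (K \<cdot> K)"
    by (rule star_eq_S_AppE) simp
  then show False
    by (simp add: star_neq_S_K_K)
qed

end
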